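(* Let $G=(Q,\Sigma,\delta,q_0)$ be a normal deterministic discrete-event system with set of secret states $Q_S\subseteq Q$ and projection $P\colon\Sigma^*\to\Sigma_o^*$, let $k\in\mathbb{N}\cup\{\infty\}$, and let $G'$, with $Q_S'$, $Q_{NS}'$ and $P'$, be obtained from $G$ by the construction described in the context. Then $G$ is strongly $k$-step opaque with respect to $Q_S$ and $P$ if and only if $G'$ is weakly $k$-step opaque with respect to $Q_S'$, $Q_{NS}'$ and $P'$.
   Context: A discrete-event system (DES) $G=(Q,\Sigma,\delta,I)$ is a nondeterministic finite automaton with finite state set $Q$, finite nonempty alphabet $\Sigma$ partitioned into observable events $\Sigma_o$ and unobservable events $\Sigma_{uo}$, nonempty set $I\subseteq Q$ of initial states, and transition function $\delta\colon Q\times\Sigma\to2^Q$ extended to $2^Q\times\Sigma^*$ as usual (also viewed as a relation $\delta\subseteq Q\times\Sigma\times Q$). It is deterministic if $I=\{q_0\}$ is a singleton and $|\delta(q,a)|\le1$ for all $q,a$ (so $\delta$ is a partial function); then one writes $G=(Q,\Sigma,\delta,q_0)$. The generated language is $L(G)=\{w\in\Sigma^*\mid\delta(I,w)\neq\emptyset\}$. The projection $P\colon\Sigma^*\to\Sigma_o^*$ is the monoid morphism erasing the unobservable events and fixing the observable ones. Weak $k$-step opacity: a DES $G=(Q,\Sigma,\delta,I)$ is weakly $k$-step opaque with respect to sets $Q_S,Q_{NS}\subseteq Q$ of secret and nonsecret states and $P$ if for every string $st\in L(G)$ with $|P(t)|\le k$ and $\delta(\delta(I,s)\cap Q_S,t)\ne\emptyset$,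 there is a string $s't'\in L(G)$ such that $P(s)=P(s')$, $P(t)=P(t')$ and $\delta(\delta(I,s')\cap Q_{NS},t')\ne\emptyset$. Strong $k$-step opacity: a deterministic DES $G=(Q,\Sigma,\delta,q_0)$ is strongly $k$-step opaque with respect to the set $Q_S$ of secret states and $P$ if for every $s\in L(G)$ there is $w\in L(G)$ such that $P(s)=P(w)$ and, for every prefix $w'$ of $w$, if $|P(w)|-|P(w')|\le k$, then $\delta(q_0,w')\notin Q_S$. For $G$, all states that are not secret are nonsecret: $Q_{NS}=Q-Q_S$. The DES $G$ is normal if it has no unobservable transition from a secret state to a nonsecret state. Construction of $G'$: let $Q_{NS}'=\{q'\mid q\in Q_{NS}\}$ be a copy of $Q_{NS}$ disjoint from $Q$, and let $G_{ns}$, with state set $Q_{NS}'$ and transition relation $\delta_{ns}=\{(p',a,q')\mid (p,a,q)\in\delta,\ p,q\in Q_{NS}\}$, be the (copy of the) automaton obtained from $G$ by removing all secret states and corresponding transitions. Let $u\notin\Sigma$ be a new unobservable event. Then $G'=(Q\cup Q_{NS}',\Sigma\cup\{u\},\delta',q_0)$ with $\delta'=\delta\cup\delta_{ns}\cup\{(q,u,q')\mid q\in Q_{NS}\}$. The set of secret states of $G'$ is $Q_S'=Q$, the set of nonsecret states is $Q_{NS}'$, and $P'\colon(\Sigma\cup\{u\})^*\to\Sigma_o^*$ is the projection erasing $\Sigma_{uo}\cup\{u\}$. *)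

theory Defs
  imports Main "HOL-Library.Extended_Nat" "HOL-Library.Sublist"
begin

record ('q, 'a) des =
  states :: "'q set"
  obs :: "'a set"
  unobs :: "'a set"
  delta :: "('q \<times> 'a \<times> 'q) set"
  init :: "'q set"

definition events :: "('q, 'a) des \<Rightarrow> 'a set" where
  "events G = obs G \<union> unobs G"

definition des :: "('q, 'a) des \<Rightarrow> bool" where
  "des G \<longleftrightarrow>
     finite (states G) \<and>
     finite (events G) \<and> events G \<noteq> {} \<and> obs G \<inter> unobs G = {} \<and>
     delta G \<subseteq> states G \<times> events G \<times> states G \<and>
     init G \<noteq> {} \<and> init G \<subseteq> states G"

definition step :: "('q, 'a) des \<Rightarrow> 'q \<Rightarrow> 'a \<Rightarrow> 'q set" where
  "step G q a = {r. (q, a, r) \<in> delta G}"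

primrec reach :: "('q, 'a) des \<Rightarrow> 'q set \<Rightarrow> 'a list \<Rightarrow> 'q set" where
  "reach G A [] = A"
| "reach G A (a # w) = reach G (\<Union>q\<in>A. step G q a) w"

definition deterministic :: "('q, 'a) des \<Rightarrow> bool" where
  "deterministic G \<longleftrightarrow>
     (\<exists>q0. init G = {q0}) \<and>
     (\<forall>q\<in>states G. \<forall>a\<in>events G. card (step G q a) \<le> 1)"

definition lang :: "('q, 'a) des \<Rightarrow> 'a list set" where
  "lang G = {w \<in> lists (events G). reach G (init G) w \<noteq> {}}"

definition proj :: "('q, 'a) des \<Rightarrow> 'a list \<Rightarrow> 'a list" where
  "proj G w = filter (\<lambda>a. a \<in> obs G) w"

text \<open>The parameter \<open>k\<close> of both opacity notions ranges over the natural numbers and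
  \<open>\<infinity>\<close>, hence has type \<open>enat\<close>.\<close>

definition weakly_opaque ::
  "('q, 'a) des \<Rightarrow> enat \<Rightarrow> 'q set \<Rightarrow> 'q set \<Rightarrow> ('a list \<Rightarrow> 'a list) \<Rightarrow> bool" where
  "weakly_opaque G k QS QNS P \<longleftrightarrow>
     (\<forall>s t. s @ t \<in> lang G \<longrightarrow> enat (length (P t)) \<le> k \<longrightarrow>
        reach G (reach G (init G) s \<inter> QS) t \<noteq> {} \<longrightarrow>
        (\<exists>s' t'. s' @ t' \<in> lang G \<and> P s = P s' \<and> P t = P t' \<and>
           reach G (reach G (init G) s' \<inter> QNS) t' \<noteq> {}))"

text \<open>Strong opacity is meant for deterministic systems only.  There, for a prefix \<open>w'\<close> of a
  generated string, \<open>reach G (init G) w'\<close> is the singleton of the state reached by \<open>w'\<close>, and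
  disjointness from \<open>QS\<close> says that this state is not secret.  The subtraction does not truncate
  when \<open>P\<close> is a projection, since then \<open>P w'\<close> is a prefix of \<open>P w\<close>.\<close>

definition strongly_opaque ::
  "('q, 'a) des \<Rightarrow> enat \<Rightarrow> 'q set \<Rightarrow> ('a list \<Rightarrow> 'a list) \<Rightarrow> bool" where
  "strongly_opaque G k QS P \<longleftrightarrow>
     (\<forall>s\<in>lang G. \<exists>w\<in>lang G. P s = P w \<and>
        (\<forall>w'. prefix w' w \<longrightarrow> enat (length (P w) - length (P w')) \<le> k \<longrightarrow>
           reach G (init G) w' \<inter> QS = {}))"

definition normal_des :: "('q, 'a) des \<Rightarrow> 'q set \<Rightarrow> bool" where
  "normal_des G QS \<longleftrightarrow>
     \<not> (\<exists>p a q. (p, a, q) \<in> delta G \<and> a \<in> unobs G \<and> p \<in> QS \<and> q \<in> states G - QS)"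

text \<open>The disjoint copy of the nonsecret states is given by an arbitrary map \<open>cp\<close>, sending \<open>q\<close> to
  its copy, that is injective on the nonsecret states and avoids the states of \<open>G\<close>.\<close>

definition is_copy :: "('q, 'a) des \<Rightarrow> 'q set \<Rightarrow> ('q \<Rightarrow> 'q) \<Rightarrow> bool" where
  "is_copy G QS cp \<longleftrightarrow>
     inj_on cp (states G - QS) \<and> cp ` (states G - QS) \<inter> states G = {}"

definition delta_ns ::
  "('q, 'a) des \<Rightarrow> 'q set \<Rightarrow> ('q \<Rightarrow> 'q) \<Rightarrow> ('q \<times> 'a \<times> 'q) set" where
  "delta_ns G QS cp =
     {(cp p, a, cp q) | p a q. (p, a, q) \<in> delta G \<and> p \<in> states G - QS \<and> q \<in> states G - QS}"

definition extension ::
  "('q, 'a) des \<Rightarrow> 'q set \<Rightarrow> ('q \<Rightarrow> 'q) \<Rightarrow> 'a \<Rightarrow> ('q, 'a) des" where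
  "extension G QS cp u =
     \<lparr>states = states G \<union> cp ` (states G - QS),
      obs = obs G,
      unobs = insert u (unobs G),
      delta = delta G \<union> delta_ns G QS cp \<union> {(q, u, cp q) | q. q \<in> states G - QS},
      init = init G\<rparr>"

lemma des_extension:
  assumes "des G" "u \<notin> events G"
  shows "des (extension G QS cp u)"
  using assms unfolding des_def extension_def events_def delta_ns_def by auto

end

theory Submission
  imports Defs
begin

text \<open>The event \<open>u\<close> marks the moment from which a run of the extension commits itself to avoiding
  secret states: a run ending in a copy is a run of \<open>G\<close> whose part after \<open>u\<close> visits nonsecret states
  only.  Strong opacity supplies such a run for every observation, with \<open>u\<close> inserted after the
  observations of \<open>s\<close>.  Conversely, given a string of \<open>G\<close>, apply weak opacity with \<open>t\<close> comprising its
  last \<open>k\<close> observations (or the whole string if there are fewer).  The run obtained is nonsecret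
  from \<open>u\<close> on; the prefixes that end before \<open>u\<close> but still lie in the window of \<open>k\<close> observations are
  separated from \<open>u\<close> by unobservable events only, so they are nonsecret by normality.\<close>

text \<open>The automaton \<open>G_ns\<close> on the original state names, so that its runs compare
  directly with those of \<open>G\<close>; copies enter only through \<open>cp\<close>. Only
  transitions are removed, so the empty string still reaches a secret starting state.\<close>

definition nonsecret_part :: "('q, 'a) des \<Rightarrow> 'q set \<Rightarrow> ('q, 'a) des" where
  "nonsecret_part G QS = G\<lparr>delta := {(p, a, q) \<in> delta G. p \<notin> QS \<and> q \<notin> QS}\<rparr>"

lemma step_nonsecret_part:
  "step (nonsecret_part G QS) p a = (if p \<in> QS then {} else step G p a - QS)"
  by (auto simp: nonsecret_part_def step_def)

section \<open>Reachable sets: single runs, monotonicity, determinism\<close>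

lemma reach_append: "reach G A (v @ w) = reach G (reach G A v) w"
  by (induction v arbitrary: A) auto

text \<open>Lets membership in a reachable set be traced back to one starting state, which turns
  statements about sets into statements about single runs.\<close>

lemma reach_UN: "reach G A w = (\<Union>q\<in>A. reach G {q} w)"
proof (induction w arbitrary: A)
  case (Cons a w)
  show ?case
    using Cons[of "\<Union>q\<in>A. step G q a"] Cons[of "step G _ a"] by auto
qed simp

lemma reach_singleton_Cons:
  "r \<in> reach G {p} (a # w) \<longleftrightarrow> (\<exists>q. (p, a, q) \<in> delta G \<and> r \<in> reach G {q} w)"
  using reach_UN[of G "step G p a" w] by (auto simp: step_def)

lemma reach_mono:
  assumes "A \<subseteq> B" "delta G \<subseteq> delta H"
  shows "reach G A w \<subseteq> reach H B w"
  using assms(1)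
proof (induction w arbitrary: A B)
  case (Cons a w)
  have "(\<Union>q\<in>A. step G q a) \<subseteq> (\<Union>q\<in>B. step H q a)"
    using Cons.prems assms(2) by (auto simp: step_def)
  then show ?case
    using Cons.IH by simp
qed simp

lemma reach_subset_states:
  assumes "des G" "A \<subseteq> states G"
  shows "reach G A w \<subseteq> states G"
  using assms(2)
proof (induction w arbitrary: A)
  case (Cons a w)
  have "(\<Union>q\<in>A. step G q a) \<subseteq> states G"
    using assms(1) by (auto simp: step_def des_def)
  then show ?case
    using Cons.IH by simp
qed simp

lemma reach_nonempty_events:
  assumes "des G" "reach G A w \<noteq> {}"
  shows "w \<in> lists (events G)"
  using assms(2)
proof (induction w arbitrary: A)
  case (Cons a w)
  have "a \<in> events G"
  proof (rule ccontr)
    assume "a \<notin> events G"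
    then have "(\<Union>q\<in>A. step G q a) = {}"
      using assms(1) by (auto simp: step_def des_def)
    moreover have "reach G {} w = {}"
      using reach_UN[of G "{}" w] by simp
    ultimately show False
      using Cons.prems by simp
  qed
  then show ?case
    using Cons by simp
qed simp

lemma lang_iff_reach_nonempty:
  assumes "des G"
  shows "w \<in> lang G \<longleftrightarrow> reach G (init G) w \<noteq> {}"
  using reach_nonempty_events[OF assms] by (auto simp: lang_def)

text \<open>Strong opacity requires a whole reachable set to miss \<open>QS\<close>; with uniqueness
  it suffices to exhibit one nonsecret state in it.\<close>

lemma reach_deterministic_unique:
  assumes "des G" "deterministic G" "p \<in> states G" "q \<in> reach G {p} w" "r \<in> reach G {p} w"
  shows "q = r"
  using assms(3-5)
proof (induction w arbitrary: p)
  case (Cons a w)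
  obtain q' r' where q': "(p, a, q') \<in> delta G" "q \<in> reach G {q'} w"
    and r': "(p, a, r') \<in> delta G" "r \<in> reach G {r'} w"
    using Cons.prems unfolding reach_singleton_Cons by blast
  have pa: "a \<in> events G" "q' \<in> states G" "step G p a \<subseteq> states G" "finite (states G)"
    using assms(1) q'(1) by (auto simp: des_def step_def)
  then have "finite (step G p a)"
    using finite_subset by blast
  moreover have "card (step G p a) \<le> 1"
    using assms(2) Cons.prems(1) pa(1) by (simp add: deterministic_def)
  ultimately have "q' = r'"
    using q'(1) r'(1) by (auto simp: card_le_Suc0_iff_eq step_def)
  then show ?case
    using Cons.IH q' r' pa(2) by blast
qed simp

section \<open>Cutting a string at a given point of its observation\<close>

lemma filter_eq_appendE:
  assumes "filter Q w = x @ y"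
  obtains v z where "w = v @ z" "filter Q v = x" "filter Q z = y"
proof -
  have "\<exists>v z. w = v @ z \<and> filter Q v = x \<and> filter Q z = y"
    using assms
  proof (induction w arbitrary: x)
    case (Cons a w)
    show ?case
    \<comment> \<open>The cut is made when \<open>x\<close> is used up and the next letter is kept
      by the filter. Erased letters met before that go into the first part.\<close>
    proof (cases "Q a \<and> x = []")
      case True
      then show ?thesis
        using Cons.prems by (intro exI[of _ "[]"] exI[of _ "a # w"]) simp
    next
      case False
      define x' where "x' = (if Q a then tl x else x)"
      have x: "x = (if Q a then a # x' else x')"
        using False Cons.prems by (cases x) (auto simp: x'_def)
      then have "filter Q w = x' @ y"
        using Cons.prems by (auto split: if_splits)
      then obtain v z where "w = v @ z" "filter Q v = x'" "filter Q z = y"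
        using Cons.IH by blast
      then show ?thesis
        using x by (intro exI[of _ "a # v"] exI[of _ z]) simp
    qed
  qed simp
  then show ?thesis
    using that by blast
qed

lemma proj_append: "proj G (v @ w) = proj G v @ proj G w"
  by (simp add: proj_def)

lemma proj_eq_appendE:
  assumes "proj G w = x @ y"
  obtains v z where "w = v @ z" "proj G v = x" "proj G z = y"
  using assms filter_eq_appendE unfolding proj_def by metis

section \<open>Runs that avoid secret states\<close>

text \<open>Both ends of every transition taken are reached by prefixes of \<open>w\<close>, so none
  of these transitions is removed.\<close>

lemma reach_nonsecret_part_eq:
  assumes "\<And>v. prefix v w \<Longrightarrow> reach G A v \<inter> QS = {}"
  shows "reach (nonsecret_part G QS) A w = reach G A w"
  using assms
proof (induction w arbitrary: A)
  case (Cons a w)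
  let ?B = "\<Union>q\<in>A. step G q a"
  have "A \<inter> QS = {}" "?B \<inter> QS = {}"
    using Cons.prems[of "[]"] Cons.prems[of "[a]"] by auto
  then have "(\<Union>q\<in>A. step (nonsecret_part G QS) q a) = ?B"
    by (force simp: step_nonsecret_part)
  moreover have "reach (nonsecret_part G QS) ?B w = reach G ?B w"
  proof (rule Cons.IH)
    fix v assume "prefix v w"
    then show "reach G ?B v \<inter> QS = {}"
      using Cons.prems[of "a # v"] by simp
  qed
  ultimately show ?case by simp
qed simp

text \<open>Every transition of the nonsecret part ends outside \<open>QS\<close>; the assumption on
  \<open>p\<close> settles the empty string.\<close>

lemma reach_nonsecret_part_nonsecret:
  assumes "r \<in> reach (nonsecret_part G QS) {p} w" "p \<notin> QS"
  shows "r \<notin> QS"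
  using assms
proof (induction w arbitrary: p)
  case (Cons a w)
  then show ?case
    unfolding reach_singleton_Cons by (auto simp: nonsecret_part_def)
qed simp

lemma reach_nonsecret_part_subset: "reach (nonsecret_part G QS) A w \<subseteq> reach G A w"
  by (rule reach_mono) (auto simp: nonsecret_part_def)

section \<open>Runs of the extension\<close>

text \<open>Transitions of \<open>G\<close> and the added \<open>u\<close> transitions start in
  \<open>states G\<close>, so only copied transitions leave a copy. Injectivity of \<open>cp\<close>
  recovers the transition of \<open>G\<close> behind each of them.\<close>

lemma reach_extension_copy:
  assumes "des G" "is_copy G QS cp" "p \<in> states G - QS"
  shows "reach (extension G QS cp u) {cp p} w = cp ` reach (nonsecret_part G QS) {p} w"
  using assms(3)
proof (induction w arbitrary: p)
  case (Cons a w)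
  let ?N = "nonsecret_part G QS" and ?G' = "extension G QS cp u"
  have copy: "cp p \<notin> states G" "inj_on cp (states G - QS)"
    using assms(2) Cons.prems by (auto simp: is_copy_def)
  have "step ?G' (cp p) a = cp ` step ?N p a"
  proof
    show "step ?G' (cp p) a \<subseteq> cp ` step ?N p a"
    proof
      fix x assume "x \<in> step ?G' (cp p) a"
      then have "(cp p, a, x) \<in> delta_ns G QS cp"
        using assms(1) copy(1) by (auto simp: step_def extension_def des_def)
      then obtain p' q where "cp p = cp p'" "x = cp q" "(p', a, q) \<in> delta G"
        "p' \<in> states G - QS" "q \<in> states G - QS"
        by (auto simp: delta_ns_def)
      moreover from this have "p' = p"
        using copy(2) Cons.prems by (metis inj_onD)
      ultimately show "x \<in> cp ` step ?N p a"
        by (auto simp: step_def nonsecret_part_def)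
    qed
    show "cp ` step ?N p a \<subseteq> step ?G' (cp p) a"
    proof (intro image_subsetI)
      fix q assume "q \<in> step ?N p a"
      then have "(p, a, q) \<in> delta G" "q \<in> states G - QS"
        using assms(1) by (auto simp: step_def nonsecret_part_def des_def)
      then have "(cp p, a, cp q) \<in> delta_ns G QS cp"
        unfolding delta_ns_def using Cons.prems by blast
      then show "cp q \<in> step ?G' (cp p) a"
        by (simp add: step_def extension_def)
    qed
  qed
  then have "reach ?G' {cp p} (a # w) = (\<Union>q\<in>step ?N p a. reach ?G' {cp q} w)"
    using reach_UN[of ?G' "cp ` step ?N p a"] by simp
  also have "\<dots> = (\<Union>q\<in>step ?N p a. cp ` reach ?N {q} w)"
  proof (rule SUP_cong)
    fix q assume "q \<in> step ?N p a"
    then have "q \<in> states G - QS"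
      using assms(1) by (auto simp: step_def nonsecret_part_def des_def)
    then show "reach ?G' {cp q} w = cp ` reach ?N {q} w"
      by (rule Cons.IH)
  qed simp
  also have "\<dots> = cp ` reach ?N {p} (a # w)"
    using reach_UN[of ?N "step ?N p a" w] by auto
  finally show ?case .
qed simp

text \<open>From \<open>states G\<close>, copies are entered only by an added \<open>u\<close>
  transition, and no transition leads back; the second case cuts \<open>w\<close> there. The first
  case records \<open>r \<in> states G\<close> so that it can be excluded when \<open>r\<close> is a
  copy.\<close>

lemma reach_extension_cases:
  assumes "des G" "is_copy G QS cp" "p \<in> states G" "r \<in> reach (extension G QS cp u) {p} w"
  obtains (original) "r \<in> states G" "r \<in> reach G {p} w"
  | (copy) w1 w2 q r' where "w = w1 @ u # w2" "q \<in> reach G {p} w1" "q \<in> states G - QS"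
      "r = cp r'" "r' \<in> reach (nonsecret_part G QS) {q} w2"
proof -
  let ?N = "nonsecret_part G QS" and ?G' = "extension G QS cp u"
  have "r \<in> states G \<and> r \<in> reach G {p} w \<or>
      (\<exists>w1 w2 q r'. w = w1 @ u # w2 \<and> q \<in> reach G {p} w1 \<and> q \<in> states G - QS \<and>
        r = cp r' \<and> r' \<in> reach ?N {q} w2)"
    using assms(3,4)
  proof (induction w arbitrary: p)
    case (Cons a w)
    obtain q where q: "(p, a, q) \<in> delta ?G'" "r \<in> reach ?G' {q} w"
      using Cons.prems(2) unfolding reach_singleton_Cons by blast
    have "(p, a, q) \<notin> delta_ns G QS cp"
      using assms(2) Cons.prems(1) by (auto simp: delta_ns_def is_copy_def)
    then consider "(p, a, q) \<in> delta G" | "a = u" "q = cp p" "p \<in> states G - QS"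
      using q(1) by (auto simp: extension_def)
    then show ?case
    proof cases
      case 1
      then have "q \<in> states G"
        using assms(1) by (auto simp: des_def)
      from Cons.IH[OF this q(2)] show ?thesis
      proof (elim disjE exE conjE)
        fix w1 w2 q' r'
        assume *: "w = w1 @ u # w2" "q' \<in> reach G {q} w1" "q' \<in> states G - QS"
          "r = cp r'" "r' \<in> reach ?N {q'} w2"
        have "q' \<in> reach G {p} (a # w1)"
          using 1 *(2) unfolding reach_singleton_Cons by blast
        with * show ?thesis
          by (intro disjI2 exI[of _ "a # w1"] exI[of _ w2] exI[of _ q'] exI[of _ r']) simp
      qed (use 1 in \<open>unfold reach_singleton_Cons, blast\<close>)
    next
      case 2
      then obtain r' where "r = cp r'" "r' \<in> reach ?N {p} w"
        using q(2) reach_extension_copy[OF assms(1,2)] by blast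
      with 2 show ?thesis
        by (intro disjI2 exI[of _ "[]"] exI[of _ w] exI[of _ p] exI[of _ r']) simp
    qed
  qed simp
  then show ?thesis
    using original copy by blast
qed

section \<open>Normality, and the mark \<open>u\<close> in projections and runs\<close>

text \<open>Normality keeps a run secret along unobservable events once it is in a secret state.
  Read backwards, a nonsecret end forces a nonsecret start.\<close>

lemma normal_des_nonsecret_backward:
  assumes "des G" "normal_des G QS" "r \<in> reach G {p} w" "proj G w = []" "r \<notin> QS"
  shows "p \<notin> QS"
  using assms(3,4)
proof (induction w arbitrary: p)
  case (Cons a w)
  obtain q where q: "(p, a, q) \<in> delta G" "r \<in> reach G {q} w"
    using Cons.prems(1) unfolding reach_singleton_Cons by blast
  have *: "a \<notin> obs G" "proj G w = []"
    using Cons.prems(2) by (auto simp: proj_def split: if_splits)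
  then have "q \<notin> QS" "a \<in> unobs G" "q \<in> states G"
    using Cons.IH[OF q(2)] q(1) assms(1) by (auto simp: des_def events_def)
  then show ?case
    using assms(2) q(1) by (auto simp: normal_des_def)
qed (use assms(5) in simp)

lemma proj_extension: "proj (extension G QS cp u) w = proj G w"
  by (simp add: proj_def extension_def)

lemma reach_extension_insert_mark:
  assumes "des G" "is_copy G QS cp" "p \<in> states G" "q \<in> reach G {p} v" "q \<notin> QS"
  shows "cp q \<in> reach (extension G QS cp u) {p} (v @ [u])"
proof -
  let ?G' = "extension G QS cp u"
  have "q \<in> reach ?G' {p} v" "q \<in> states G"
    using assms reach_mono[of "{p}" "{p}" G ?G' v] reach_subset_states[of G "{p}" v]
    by (auto simp: extension_def)
  moreover have "cp q \<in> step ?G' q u"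
    using \<open>q \<in> states G\<close> assms(5) by (auto simp: step_def extension_def)
  ultimately show ?thesis
    by (auto simp: reach_append)
qed

section \<open>From strong to weak opacity\<close>

lemma strongly_imp_weakly_opaque:
  assumes "des G" "deterministic G" "is_copy G QS cp" "u \<notin> events G"
    and strong: "strongly_opaque G k QS (proj G)"
  shows "weakly_opaque (extension G QS cp u) k (states G) (cp ` (states G - QS))
    (proj (extension G QS cp u))"
  unfolding weakly_opaque_def proj_extension
proof (intro allI impI)
  let ?G' = "extension G QS cp u" and ?N = "nonsecret_part G QS"
  have desG': "des ?G'"
    using assms(1,4) by (rule des_extension)
  obtain q0 where q0: "init G = {q0}" "init ?G' = {q0}" "q0 \<in> states G"
    using assms(1,2) by (auto simp: deterministic_def des_def extension_def)
  fix s t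
  assume "s @ t \<in> lang ?G'" and k: "enat (length (proj G t)) \<le> k"
  then obtain r where "r \<in> reach ?G' {q0} (s @ t)"
    using q0(2) by (auto simp: lang_def)
  with assms(1,3) q0(3)
  \<comment> \<open>Strong opacity applies to strings of \<open>G\<close> only. If the run ends in a
    copy, deleting the mark gives a string of \<open>G\<close> with the same observation.\<close>
  have "\<exists>x. proj G x = proj G (s @ t) \<and> reach G {q0} x \<noteq> {}"
  proof (cases rule: reach_extension_cases)
    case (copy w1 w2 q r')
    then have "r' \<in> reach G {q0} (w1 @ w2)"
      using reach_nonsecret_part_subset[of G QS "{q}" w2] reach_UN[of G "reach G {q0} w1" w2]
      by (auto simp: reach_append)
    moreover have "proj G (w1 @ w2) = proj G (s @ t)"
      using copy(1) assms(4) by (auto simp: proj_def events_def)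
    ultimately show ?thesis by blast
  qed blast
  then obtain w where w: "proj G w = proj G s @ proj G t" "reach G {q0} w \<noteq> {}"
    "\<And>v. prefix v w \<Longrightarrow> enat (length (proj G w) - length (proj G v)) \<le> k
      \<Longrightarrow> reach G {q0} v \<inter> QS = {}"
    using strong lang_iff_reach_nonempty[OF assms(1)] q0(1)
    unfolding strongly_opaque_def proj_append by metis
  obtain v z where vz: "w = v @ z" "proj G v = proj G s" "proj G z = proj G t"
    using w(1) by (rule proj_eq_appendE)
  \<comment> \<open>Since \<open>z\<close> carries the observations of \<open>t\<close>, a prefix of
    \<open>w\<close> extending \<open>v\<close> lacks at most \<open>length (proj G t)\<close>
    observations, hence at most \<open>k\<close>.\<close>
  have window: "reach G (reach G {q0} v) y \<inter> QS = {}" if y: "prefix y z" for y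
  proof -
    have "enat (length (proj G w) - length (proj G (v @ y))) \<le> enat (length (proj G t))"
      using vz by (simp add: proj_append)
    then have "enat (length (proj G w) - length (proj G (v @ y))) \<le> k"
      using k by (rule order_trans)
    then show ?thesis
      using w(3)[of "v @ y"] y vz(1) by (simp add: reach_append)
  qed
  then have "reach ?N (reach G {q0} v) z = reach G {q0} w"
    using reach_nonsecret_part_eq vz(1) by (metis reach_append)
  then obtain q r where q: "q \<in> reach G {q0} v" and r: "r \<in> reach ?N {q} z"
    using w(2) reach_UN[of ?N "reach G {q0} v" z] by blast
  have qns: "q \<in> states G - QS"
    using window[of "[]"] q reach_subset_states[OF assms(1), of "{q0}" v] q0(3) by auto
  \<comment> \<open>The mark becomes the last event of \<open>s'\<close>, so the state after
    \<open>s'\<close> is already a copy, that is, nonsecret in the extension.\<close>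
  have "cp q \<in> reach ?G' {q0} (v @ [u]) \<inter> cp ` (states G - QS)"
    using reach_extension_insert_mark[OF assms(1,3) q0(3) q] qns by auto
  moreover have "cp r \<in> reach ?G' {cp q} z"
    using reach_extension_copy[OF assms(1,3) qns] r by blast
  ultimately have reached: "reach ?G' (reach ?G' {q0} (v @ [u]) \<inter> cp ` (states G - QS)) z \<noteq> {}"
    using reach_mono[of "{cp q}" "reach ?G' {q0} (v @ [u]) \<inter> cp ` (states G - QS)" ?G' ?G' z]
    by blast
  then have "reach ?G' {q0} ((v @ [u]) @ z) \<noteq> {}"
    unfolding reach_append[of _ _ "v @ [u]"]
    using reach_mono[of "reach ?G' {q0} (v @ [u]) \<inter> cp ` (states G - QS)"
        "reach ?G' {q0} (v @ [u])" ?G' ?G' z] by blast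
  then have "(v @ [u]) @ z \<in> lang ?G'"
    using lang_iff_reach_nonempty[OF desG'] q0(2) by simp
  moreover have "proj G (v @ [u]) = proj G s"
    using vz(2) assms(4) by (simp add: proj_def events_def)
  ultimately show "\<exists>s' t'. s' @ t' \<in> lang ?G' \<and> proj G s = proj G s' \<and> proj G t = proj G t' \<and>
      reach ?G' (reach ?G' (init ?G') s' \<inter> cp ` (states G - QS)) t' \<noteq> {}"
    using reached vz(3) q0(2) by metis
qed

section \<open>From weak to strong opacity\<close>

text \<open>The part \<open>t\<close> takes the minimum of \<open>k\<close> and the number of
  observations of \<open>w\<close>. Stating this as maximality spares later arguments the
  distinction between finite and infinite \<open>k\<close>.\<close>

lemma split_last_observations:
  fixes k :: enat
  obtains s t where "w = s @ t" "enat (length (proj G t)) \<le> k"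
    "\<And>n. n \<le> length (proj G w) \<Longrightarrow> enat n \<le> k \<Longrightarrow> n \<le> length (proj G t)"
proof -
  let ?L = "length (proj G w)"
  define m where "m = (case k of enat j \<Rightarrow> min j ?L | \<infinity> \<Rightarrow> ?L)"
  have m: "m \<le> ?L" "enat m \<le> k" "\<And>n. n \<le> ?L \<Longrightarrow> enat n \<le> k \<Longrightarrow> n \<le> m"
    by (auto simp: m_def split: enat.splits)
  obtain s t where "w = s @ t" "proj G t = drop (?L - m) (proj G w)"
    using proj_eq_appendE[OF append_take_drop_id[symmetric]] by metis
  then show ?thesis
    using that[of s t] m by simp
qed

lemma weakly_imp_strongly_opaque:
  assumes "des G" "deterministic G" "normal_des G QS" "is_copy G QS cp" "u \<notin> events G"
    and weak: "weakly_opaque (extension G QS cp u) k (states G) (cp ` (states G - QS))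
      (proj (extension G QS cp u))"
  shows "strongly_opaque G k QS (proj G)"
  unfolding strongly_opaque_def
proof
  let ?G' = "extension G QS cp u" and ?N = "nonsecret_part G QS"
  have desG': "des ?G'"
    using assms(1,5) by (rule des_extension)
  obtain q0 where q0: "init G = {q0}" "init ?G' = {q0}" "q0 \<in> states G"
    using assms(1,2) by (auto simp: deterministic_def des_def extension_def)
  fix x assume "x \<in> lang G"
  then have x: "reach G {q0} x \<noteq> {}"
    using q0(1) by (simp add: lang_def)
  obtain s t where st: "x = s @ t" "enat (length (proj G t)) \<le> k"
    "\<And>n. n \<le> length (proj G x) \<Longrightarrow> enat n \<le> k \<Longrightarrow> n \<le> length (proj G t)"
    using split_last_observations[of x G k] by blast
  have sub: "reach G A v \<subseteq> reach ?G' A v" for A v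
    by (rule reach_mono) (auto simp: extension_def)
  \<comment> \<open>All of \<open>states G\<close> is secret in the extension, so a run of
    \<open>G\<close> on \<open>s @ t\<close> meets the secrecy premise of weak opacity.\<close>
  have "reach G {q0} s \<subseteq> reach ?G' {q0} s \<inter> states G"
    using sub reach_subset_states[OF assms(1)] q0(3) by simp
  then have "reach G {q0} x \<subseteq> reach ?G' (reach ?G' {q0} s \<inter> states G) t"
    unfolding st(1) reach_append by (rule reach_mono) (auto simp: extension_def)
  then have "reach ?G' (reach ?G' (init ?G') s \<inter> states G) t \<noteq> {}"
    using x q0(2) by auto
  moreover have "s @ t \<in> lang ?G'"
    using lang_iff_reach_nonempty[OF desG'] sub[of "{q0}" x] x q0(2) st(1) by auto
  ultimately obtain s' t' where s't': "proj G s = proj G s'" "proj G t = proj G t'"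
    "reach ?G' (reach ?G' {q0} s' \<inter> cp ` (states G - QS)) t' \<noteq> {}"
    using weak st(2) unfolding weakly_opaque_def proj_extension q0(2) by blast
  then obtain p r where p: "cp p \<in> reach ?G' {q0} s'" "p \<in> states G - QS"
    and "r \<in> reach ?G' {cp p} t'"
    using reach_UN[of ?G' "reach ?G' {q0} s' \<inter> cp ` (states G - QS)" t'] by auto
  then obtain r' where r': "r' \<in> reach ?N {p} t'"
    using reach_extension_copy[OF assms(1,4)] by blast
  from assms(1,4) q0(3) p(1)
  obtain v z q where vz: "s' = v @ u # z" "q \<in> reach G {q0} v" "q \<in> states G - QS"
    "p \<in> reach ?N {q} z"
  proof (cases rule: reach_extension_cases)
    case original
    then show ?thesis
      using p(2) assms(4) by (auto simp: is_copy_def)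
  next
    case (copy w1 w2 q p')
    \<comment> \<open>From \<open>cp p' = cp p\<close> follows \<open>p' = p\<close> only for
      nonsecret states of \<open>G\<close>, so \<open>p'\<close> is first shown to be one.\<close>
    have "p' \<in> reach G {q} w2"
      by (rule subsetD[OF reach_nonsecret_part_subset copy(5)])
    then have "p' \<in> states G"
      using reach_subset_states[OF assms(1), of "{q}"] copy(3) by auto
    moreover have "p' \<notin> QS"
      using reach_nonsecret_part_nonsecret copy(3,5) by fastforce
    ultimately have "p' = p"
      using copy(4) p(2) assms(4) by (metis DiffI inj_onD is_copy_def)
    then show ?thesis
      using that copy by blast
  qed
  \<comment> \<open>The string sought is \<open>v @ y\<close>, which is \<open>s' @ t'\<close> with
    the mark deleted; \<open>y\<close> is all that follows the mark.\<close>
  define y where "y = z @ t'"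
  have r'y: "r' \<in> reach ?N {q} y"
    using vz(4) r' reach_UN[of ?N "reach ?N {q} z" t'] by (auto simp: y_def reach_append)
  have proj_v: "proj G s' = proj G v @ proj G z"
    using vz(1) assms(5) by (simp add: proj_def events_def)
  have proj_w: "proj G (v @ y) = proj G x"
    using proj_v s't'(1,2) st(1) by (simp add: y_def proj_append)
  have "r' \<in> reach G {q0} (v @ y)"
    using vz(2) r'y reach_nonsecret_part_subset[of G QS "{q}" y]
      reach_UN[of G "reach G {q0} v" y] by (auto simp: reach_append)
  then have "v @ y \<in> lang G"
    using lang_iff_reach_nonempty[OF assms(1)] q0(1) by auto
  moreover have "reach G {q0} w' \<inter> QS = {}"
    if w': "prefix w' (v @ y)" and k: "enat (length (proj G (v @ y)) - length (proj G w')) \<le> k"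
    for w'
  proof -
    have "\<exists>m \<in> reach G {q0} w'. m \<notin> QS"
    proof (cases "prefix w' v")
      case True
      then obtain d where d: "v = w' @ d"
        by (auto elim: prefixE)
      then obtain m where m: "m \<in> reach G {q0} w'" "q \<in> reach G {m} d"
        using vz(2) reach_UN[of G "reach G {q0} w'" d] by (auto simp: reach_append)
      \<comment> \<open>The prefix \<open>w'\<close> lacks the observations of \<open>d\<close>,
        \<open>z\<close> and \<open>t'\<close>. By maximality of \<open>t\<close> these number at
        most as many as those of \<open>t\<close>, equally of \<open>t'\<close>, so \<open>d\<close>
        is unobservable and normality carries nonsecrecy from \<open>q\<close> back to
        \<open>m\<close>.\<close>
      have "length (proj G x) - length (proj G w') \<le> length (proj G t)"
        using st(3) k proj_w by simp
      then have "length (proj G v) \<le> length (proj G w')"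
        using proj_w proj_v s't' st(1) d by (simp add: proj_append)
      then have "proj G d = []"
        using d by (simp add: proj_append)
      then show ?thesis
        using normal_des_nonsecret_backward[OF assms(1,3) m(2)] vz(3) m(1) by blast
    next
      case False
      \<comment> \<open>Here \<open>w'\<close> reaches past the mark, and its remainder
        \<open>e\<close> is run inside the nonsecret part from \<open>q\<close>.\<close>
      then obtain e f where e: "w' = v @ e" "y = e @ f"
        using w' by (auto simp: prefix_append elim: prefixE)
      then obtain m where m: "m \<in> reach ?N {q} e"
        using r'y reach_UN[of ?N "reach ?N {q} e" f] by (auto simp: reach_append)
      then have "m \<in> reach G {q0} w'"
        using reach_nonsecret_part_subset[of G QS "{q}" e] vz(2) e(1)
          reach_UN[of G "reach G {q0} v" e] by (auto simp: reach_append)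
      moreover have "m \<notin> QS"
        using reach_nonsecret_part_nonsecret m vz(3) by fastforce
      ultimately show ?thesis by blast
    qed
    then show ?thesis
      using reach_deterministic_unique[OF assms(1,2) q0(3)] by blast
  qed
  ultimately show "\<exists>w\<in>lang G. proj G x = proj G w \<and>
      (\<forall>w'. prefix w' w \<longrightarrow> enat (length (proj G w) - length (proj G w')) \<le> k \<longrightarrow>
        reach G (init G) w' \<inter> QS = {})"
    using proj_w q0(1) by metis
qed

theorem theorem10:
  fixes G :: "('q, 'a) des" and QS :: "'q set" and k :: enat
    and cp :: "'q \<Rightarrow> 'q" and u :: 'a
  assumes "des G"
    and "deterministic G"
    and "QS \<subseteq> states G"
    and "normal_des G QS"
    and "is_copy G QS cp"
    and "u \<notin> events G"
  defines "G' \<equiv> extension G QS cp u"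
  shows "strongly_opaque G k QS (proj G) \<longleftrightarrow>
         weakly_opaque G' k (states G) (cp ` (states G - QS)) (proj G')"
  unfolding G'_def
  using strongly_imp_weakly_opaque[OF assms(1,2,5,6)]
    weakly_imp_strongly_opaque[OF assms(1,2,4,5,6)] by blast

end
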